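(* For every $\varepsilon > 0$, there is no polynomial-time $|\mathcal{J}|^{1-\varepsilon}$-approximation algorithm for generalized malleable scheduling with supermodular processing time functions (with the objective of minimizing the makespan), unless $P = NP$.
   Context: Generalized malleable scheduling with supermodular processing time functions: an instance consists of a finite set $\mathcal{J}$ of jobs, a finite set $\mathcal{M}$ of machines, and for each job $j$ a processing time set function $f_j : 2^{\mathcal{M}} \to \mathbb{R}_+$, accessed by value queries, that is non-increasing ($f_j(T) \le f_j(S)$ for $S\subseteq T$) and supermodular, i.e. $f_j(T \cup \{i\}) - f_j(T) \ge f_j(S \cup \{i\}) - f_j(S)$ for all $S \subseteq T \subseteq \mathcal{M}$ and $i \in \mathcal{M}\setminus T$. A feasible schedule chooses for each job $j$ a set $S_j \subseteq \mathcal{M}$ and a start time $\tau_j \ge 0$; job $j$ occupies all machines of $S_j$ (non-preemptively and in unison) during $[\tau_j, \tau_j + f_j(S_j)]$, and each machine processes at most one job at a time. The makespan is $\max_{j} (\tau_j + f_j(S_j))$, to be minimized. A $\rho$-approximation algorithm outputs, on every instance, a feasible schedule of makespan at most $\rho$ times the optimal makespan. *)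

theory Defs
  imports Complex_Main
begin

section \<open>Generalized malleable scheduling\<close>

definition supermodular_on :: "'m set \<Rightarrow> ('m set \<Rightarrow> real) \<Rightarrow> bool" where
  "supermodular_on M g \<longleftrightarrow>
     (\<forall>S T i. S \<subseteq> T \<and> T \<subseteq> M \<and> i \<in> M - T \<longrightarrow>
        g (T \<union> {i}) - g T \<ge> g (S \<union> {i}) - g S)"

definition nonincreasing_on :: "'m set \<Rightarrow> ('m set \<Rightarrow> real) \<Rightarrow> bool" where
  "nonincreasing_on M g \<longleftrightarrow> (\<forall>S T. S \<subseteq> T \<and> T \<subseteq> M \<longrightarrow> g T \<le> g S)"

definition scheduling_instance ::
    "'j set \<Rightarrow> 'm set \<Rightarrow> ('j \<Rightarrow> 'm set \<Rightarrow> real) \<Rightarrow> bool" where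
  "scheduling_instance J M f \<longleftrightarrow>
     finite J \<and> finite M \<and>
     (\<forall>j\<in>J. (\<forall>S\<subseteq>M. 0 \<le> f j S) \<and> nonincreasing_on M (f j) \<and> supermodular_on M (f j))"

text \<open>Half-open time intervals, so that a job may start on a machine at the very moment
  another one completes there.\<close>

definition feasible_schedule ::
    "'j set \<Rightarrow> 'm set \<Rightarrow> ('j \<Rightarrow> 'm set \<Rightarrow> real) \<Rightarrow> ('j \<Rightarrow> 'm set) \<Rightarrow> ('j \<Rightarrow> real) \<Rightarrow> bool" where
  "feasible_schedule J M f S \<tau> \<longleftrightarrow>
     (\<forall>j\<in>J. S j \<subseteq> M \<and> 0 \<le> \<tau> j) \<and>
     (\<forall>i\<in>M. \<forall>j\<in>J. \<forall>j'\<in>J. j \<noteq> j' \<and> i \<in> S j \<and> i \<in> S j' \<longrightarrow>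
        {\<tau> j ..< \<tau> j + f j (S j)} \<inter> {\<tau> j' ..< \<tau> j' + f j' (S j')} = {})"

text \<open>Completion times are nonnegative, so inserting \<open>0\<close> only matters for \<open>J = {}\<close>.\<close>

definition makespan ::
    "'j set \<Rightarrow> ('j \<Rightarrow> 'm set \<Rightarrow> real) \<Rightarrow> ('j \<Rightarrow> 'm set) \<Rightarrow> ('j \<Rightarrow> real) \<Rightarrow> real" where
  "makespan J f S \<tau> = Max (insert 0 ((\<lambda>j. \<tau> j + f j (S j)) ` J))"

text \<open>The infimum is over a nonempty set bounded below by \<open>0\<close>, since running
  the jobs one after the other is always feasible.\<close>

definition optimal_makespan ::
    "'j set \<Rightarrow> 'm set \<Rightarrow> ('j \<Rightarrow> 'm set \<Rightarrow> real) \<Rightarrow> real" where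
  "optimal_makespan J M f = Inf {makespan J f S \<tau> | S \<tau>. feasible_schedule J M f S \<tau>}"


section \<open>Multi-tape Turing machines with value queries\<close>

datatype symbol = Blank | Bit bool | Sep

datatype move = MoveLeft | Stay | MoveRight

text \<open>A tape is infinite in both directions: the cells left of the head (nearest first), the
  scanned cell, and the cells right of it; all cells beyond the two lists are blank.\<close>

datatype tape = Tape "symbol list" symbol "symbol list"

fun scanned :: "tape \<Rightarrow> symbol" where
  "scanned (Tape ls s rs) = s"

fun act :: "symbol \<times> move \<Rightarrow> tape \<Rightarrow> tape" where
  "act (s', Stay) (Tape ls s rs) = Tape ls s' rs"
| "act (s', MoveLeft) (Tape [] s rs) = Tape [] Blank (s' # rs)"
| "act (s', MoveLeft) (Tape (l # ls) s rs) = Tape ls l (s' # rs)"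
| "act (s', MoveRight) (Tape ls s []) = Tape (s' # ls) Blank []"
| "act (s', MoveRight) (Tape ls s (r # rs)) = Tape (s' # ls) r rs"

fun tape_of :: "symbol list \<Rightarrow> tape" where
  "tape_of [] = Tape [] Blank []"
| "tape_of (s # ss) = Tape [] s ss"

text \<open>The word on a tape runs from the head to the next blank.\<close>

fun tape_word :: "tape \<Rightarrow> symbol list" where
  "tape_word (Tape ls s rs) = takeWhile (\<lambda>x. x \<noteq> Blank) (s # rs)"

text \<open>\<open>Query q\<close>: submit the word on tape 1 as a query, replace the contents of tape 1 by the
  answer, and continue in state \<open>q\<close>.\<close>

datatype control = Goto nat | Query nat | Halt

record turing_machine =
  ntapes :: nat
  nstates :: nat
  delta :: "nat \<Rightarrow> symbol list \<Rightarrow> control \<times> (symbol \<times> move) list"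

fun control_ok :: "nat \<Rightarrow> control \<Rightarrow> bool" where
  "control_ok k (Goto q) \<longleftrightarrow> q < k"
| "control_ok k (Query q) \<longleftrightarrow> q < k"
| "control_ok k Halt \<longleftrightarrow> True"

definition wf_tm :: "turing_machine \<Rightarrow> bool" where
  "wf_tm A \<longleftrightarrow> 2 \<le> ntapes A \<and> 0 < nstates A \<and>
     (\<forall>q ss. q < nstates A \<and> length ss = ntapes A \<longrightarrow>
        control_ok (nstates A) (fst (delta A q ss)) \<and> length (snd (delta A q ss)) = ntapes A)"

definition query_free :: "turing_machine \<Rightarrow> bool" where
  "query_free A \<longleftrightarrow>
     (\<forall>q ss. q < nstates A \<and> length ss = ntapes A \<longrightarrow> (\<forall>q'. fst (delta A q ss) \<noteq> Query q'))"

type_synonym config = "control \<times> tape list"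

fun step :: "turing_machine \<Rightarrow> (symbol list \<Rightarrow> symbol list) \<Rightarrow> config \<Rightarrow> config" where
  "step A ans (Halt, ts) = (Halt, ts)"
| "step A ans (Query q, ts) = (Goto q, ts[1 := tape_of (ans (tape_word (ts ! 1)))])"
| "step A ans (Goto q, ts) =
     (case delta A q (map scanned ts) of (c, as) \<Rightarrow> (c, map2 act as ts))"

definition initial :: "turing_machine \<Rightarrow> symbol list \<Rightarrow> config" where
  "initial A w = (Goto 0, tape_of w # replicate (ntapes A - 1) (tape_of []))"

definition outputs_within ::
    "turing_machine \<Rightarrow> (symbol list \<Rightarrow> symbol list) \<Rightarrow> symbol list \<Rightarrow> nat \<Rightarrow> symbol list \<Rightarrow> bool" where
  "outputs_within A ans w t out \<longleftrightarrow>
     (\<exists>ts. (step A ans ^^ t) (initial A w) = (Halt, ts) \<and> tape_word (ts ! 0) = out)"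


section \<open>The classes P and NP\<close>

type_synonym language = "bool list set"

text \<open>The machine is query-free, so the answer function \<open>\<lambda>_. []\<close> is never consulted.\<close>

definition complexity_P :: "language set" where
  "complexity_P = {L. \<exists>A c d. wf_tm A \<and> query_free A \<and>
     (\<forall>x. outputs_within A (\<lambda>_. []) (map Bit x) (c * length x ^ d + c) [Bit (x \<in> L)])}"

definition pair_word :: "bool list \<Rightarrow> bool list \<Rightarrow> bool list" where
  "pair_word x y = concat (map (\<lambda>b. [b, b]) x) @ [False, True] @ y"

definition complexity_NP :: "language set" where
  "complexity_NP = {L. \<exists>V\<in>complexity_P. \<exists>c d.
     \<forall>x. x \<in> L \<longleftrightarrow> (\<exists>y. length y \<le> c * length x ^ d + c \<and> pair_word x y \<in> V)}"


section \<open>Approximation algorithms with value queries\<close>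

text \<open>Instances presented to a machine have jobs \<open>{..<n}\<close>, machines \<open>{..<m}\<close> and rational
  processing times. The input word is \<open>(n, m)\<close> in unary; the functions \<open>f j\<close> are accessible
  only through queries.\<close>

fun binary :: "nat \<Rightarrow> symbol list" where
  "binary k = (if k < 2 then [Bit (k = 1)] else binary (k div 2) @ [Bit (odd k)])"

declare binary.simps [simp del]

text \<open>For nonnegative rationals.\<close>

definition rat_word :: "rat \<Rightarrow> symbol list" where
  "rat_word r = (case quotient_of r of (a, b) \<Rightarrow> binary (nat a) @ [Sep] @ binary (nat b))"

definition set_word :: "nat \<Rightarrow> nat set \<Rightarrow> symbol list" where
  "set_word m S = map (\<lambda>i. Bit (i \<in> S)) [0..<m]"

definition input_word :: "nat \<Rightarrow> nat \<Rightarrow> symbol list" where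
  "input_word n m = replicate n (Bit True) @ [Sep] @ replicate m (Bit True)"

definition query_word :: "nat \<Rightarrow> nat \<Rightarrow> nat set \<Rightarrow> symbol list" where
  "query_word m j S = replicate j (Bit True) @ [Sep] @ set_word m S"

text \<open>Words that are not of the form \<open>query_word m j S\<close> with \<open>j < n\<close> are answered by the empty
  word.\<close>

definition value_answer ::
    "nat \<Rightarrow> nat \<Rightarrow> (nat \<Rightarrow> nat set \<Rightarrow> rat) \<Rightarrow> symbol list \<Rightarrow> symbol list" where
  "value_answer n m f w =
     (let j = length (takeWhile (\<lambda>s. s = Bit True) w);
          S = {i. i < m \<and> drop (Suc j) w ! i = Bit True}
      in if j < n \<and> w = query_word m j S then rat_word (f j S) else [])"

lemma value_answer_query_word:
  assumes "j < n" and "S \<subseteq> {..<m}"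
  shows "value_answer n m f (query_word m j S) = rat_word (f j S)"
proof -
  have 1: "length (takeWhile (\<lambda>s. s = Bit True) (query_word m j S)) = j"
    by (simp add: query_word_def takeWhile_append)
  have 2: "{i. i < m \<and> drop (Suc j) (query_word m j S) ! i = Bit True} = S"
    using assms(2) by (auto simp: query_word_def set_word_def)
  show ?thesis
    unfolding value_answer_def Let_def 1 2 using assms(1) by simp
qed

definition schedule_word ::
    "nat \<Rightarrow> nat \<Rightarrow> (nat \<Rightarrow> nat set) \<Rightarrow> (nat \<Rightarrow> rat) \<Rightarrow> symbol list" where
  "schedule_word n m S \<tau> =
     concat (map (\<lambda>j. set_word m (S j) @ [Sep] @ rat_word (\<tau> j) @ [Sep]) [0..<n])"

definition instance_size :: "nat \<Rightarrow> nat \<Rightarrow> (nat \<Rightarrow> nat set \<Rightarrow> rat) \<Rightarrow> nat" where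
  "instance_size n m f =
     n + m + Max (insert 0 {length (rat_word (f j S)) | j S. j < n \<and> S \<subseteq> {..<m}})"

text \<open>The approximation guarantee \<open>\<rho>\<close> is a function of the number of jobs.\<close>

definition poly_time_approx_algorithm :: "(nat \<Rightarrow> real) \<Rightarrow> turing_machine \<Rightarrow> bool" where
  "poly_time_approx_algorithm \<rho> A \<longleftrightarrow> wf_tm A \<and>
     (\<exists>c d. \<forall>n m (f :: nat \<Rightarrow> nat set \<Rightarrow> rat).
        let J = {..<n}; M = {..<m}; p = (\<lambda>j S. real_of_rat (f j S)) in
        scheduling_instance J M p \<longrightarrow>
        (\<exists>S \<tau>.
           outputs_within A (value_answer n m f) (input_word n m)
             (c * instance_size n m f ^ d + c) (schedule_word n m S \<tau>) \<and>
           feasible_schedule J M p S (\<lambda>j. real_of_rat (\<tau> j)) \<and>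
           makespan J p S (\<lambda>j. real_of_rat (\<tau> j)) \<le> \<rho> (card J) * optimal_makespan J M p))"

end

theory Submission
  imports Defs "HOL-Real_Asymp.Real_Asymp"
begin

text \<open>The lower bound comes from the value queries alone, with two jobs. On \<open>2 * k\<close> machines let
  both jobs have a processing time that depends only on the size of the machine set, except
  that on some hidden \<open>k\<close>-set \<open>H\<close> and on its complement it drops from 2 to 1. The optimal
  makespan is 1, but a schedule that does not use \<open>H\<close> or its complement for job 0 has makespan at
  least 2, which exceeds \<open>2 powr (1 - \<epsilon>)\<close>. A machine that asks polynomially many queries misses
  most of the exponentially many candidates for \<open>H\<close>.\<close>

section \<open>The hidden-set processing time\<close>

text \<open>Slope \<open>-2\<close> below size \<open>k\<close> makes the function supermodular whichever \<open>k\<close>-sets are in the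
  family \<open>\<H>\<close> of hidden sets.\<close>

definition hidden_time :: "nat \<Rightarrow> 'm set set \<Rightarrow> 'm set \<Rightarrow> nat" where
  "hidden_time k \<H> S =
     (if k < card S then 1
      else if card S = k then (if S \<in> \<H> then 1 else 2)
      else 1 + 2 * (k - card S))"

lemma hidden_time_ge_1: "1 \<le> hidden_time k \<H> S"
  by (simp add: hidden_time_def)

lemma hidden_time_le: "0 < k \<Longrightarrow> hidden_time k \<H> S \<le> 2 * k + 1"
  by (simp add: hidden_time_def)

lemma hidden_time_ge_2: "card S \<le> k \<Longrightarrow> S \<notin> \<H> \<Longrightarrow> 2 \<le> hidden_time k \<H> S"
  by (auto simp: hidden_time_def)

lemma nonincreasing_on_hidden_time:
  assumes "finite M"
  shows "nonincreasing_on M (\<lambda>S. real (hidden_time k \<H> S))"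
  unfolding nonincreasing_on_def
proof (intro allI impI)
  fix S T assume ST: "S \<subseteq> T \<and> T \<subseteq> M"
  show "real (hidden_time k \<H> T) \<le> real (hidden_time k \<H> S)"
  proof (cases "S = T")
    case False
    then have "card S < card T"
      using ST assms by (meson finite_subset psubsetI psubset_card_mono)
    then show ?thesis
      by (auto simp: hidden_time_def)
  qed simp
qed

text \<open>For \<open>S\<close> strictly inside \<open>T\<close>, compare marginals by
  \<open>card S\<close>. From size \<open>k\<close> on, \<open>T\<close> has reached the constant
  value 1. At size \<open>k - 1\<close> the marginal of \<open>S\<close> is at most -1, while that
  of \<open>T\<close> is at least -1. Below that it is -2, and no marginal is smaller.\<close>

lemma supermodular_on_hidden_time:
  assumes "finite M"
  shows "supermodular_on M (\<lambda>S. real (hidden_time k \<H> S))"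
  unfolding supermodular_on_def
proof (intro allI impI)
  fix S T i assume STi: "S \<subseteq> T \<and> T \<subseteq> M \<and> i \<in> M - T"
  have fin: "finite S" "finite T"
    using STi assms by (meson finite_subset)+
  show "real (hidden_time k \<H> (T \<union> {i})) - real (hidden_time k \<H> T)
      \<ge> real (hidden_time k \<H> (S \<union> {i})) - real (hidden_time k \<H> S)"
  proof (cases "S = T")
    case False
    then have lt: "card S < card T"
      using STi fin by (meson psubsetI psubset_card_mono)
    have card: "card (T \<union> {i}) = Suc (card T)" "card (S \<union> {i}) = Suc (card S)"
      using STi fin by (auto intro: card_insert_disjoint)
    consider "k \<le> card S" | "Suc (card S) = k" | "Suc (card S) < k"
      by linarith
    then show ?thesis
      by cases (use lt card in \<open>auto simp: hidden_time_def of_nat_diff\<close>)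
  qed simp
qed

lemma scheduling_instance_hidden_time:
  "finite J \<Longrightarrow> finite M \<Longrightarrow> scheduling_instance J M (\<lambda>_ S. real (hidden_time k \<H> S))"
  by (simp add: scheduling_instance_def nonincreasing_on_hidden_time supermodular_on_hidden_time)


section \<open>Makespans\<close>

lemma completion_time_le_makespan:
  "finite J \<Longrightarrow> j \<in> J \<Longrightarrow> \<tau> j + f j (S j) \<le> makespan J f S \<tau>"
  by (simp add: makespan_def)

lemma optimal_makespan_le:
  assumes "finite J" "feasible_schedule J M f S \<tau>"
  shows "optimal_makespan J M f \<le> makespan J f S \<tau>"
  unfolding optimal_makespan_def
proof (rule cInf_lower)
  show "bdd_below {makespan J f S \<tau> |S \<tau>. feasible_schedule J M f S \<tau>}"
    using assms(1) by (auto intro!: bdd_belowI[of _ 0] simp: makespan_def)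
qed (use assms in auto)

text \<open>Both jobs start at 0, one on \<open>H\<close> and one on its complement. This is why the
  complement is hidden too.\<close>

lemma optimal_makespan_hidden_time_le:
  fixes M :: "'m set" and H :: "'m set"
  assumes "card M = 2 * k" "finite M" "H \<subseteq> M" "card H = k"
  shows "optimal_makespan {..<2::nat} M (\<lambda>_ S. real (hidden_time k {H, M - H} S)) \<le> 1"
proof -
  let ?p = "\<lambda>(_::nat) S. real (hidden_time k {H, M - H} S)"
  let ?S = "\<lambda>j::nat. if j = 0 then H else M - H"
  have "card (M - H) = k"
    using assms by (simp add: card_Diff_subset finite_subset)
  then have one: "?p j (?S j) = 1" for j
    using assms by (simp add: hidden_time_def)
  have "feasible_schedule {..<2} M ?p ?S (\<lambda>_. 0)"
    using assms(3) by (auto simp: feasible_schedule_def)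
  then have "optimal_makespan {..<2} M ?p \<le> makespan {..<2} ?p ?S (\<lambda>_. 0)"
    by (intro optimal_makespan_le) simp_all
  also have "\<dots> = 1"
    unfolding makespan_def one by (simp add: image_constant_conv lessThan_empty_iff)
  finally show ?thesis .
qed

text \<open>Overlapping sets force the jobs to run one after the other, each for at least 1.
  Disjoint sets leave one job with too few machines to take less than 2.\<close>

lemma makespan_hidden_time_ge:
  assumes feas: "feasible_schedule {..<2::nat} M (\<lambda>_ S. real (hidden_time k \<H> S)) S \<tau>"
    and M: "card M = 2 * k" "finite M" and S0: "S 0 \<notin> \<H>"
  shows "2 \<le> makespan {..<2::nat} (\<lambda>_ S. real (hidden_time k \<H> S)) S \<tau>"
proof -
  let ?p = "\<lambda>(_::nat) S. real (hidden_time k \<H> S)"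
  have compl: "\<tau> 0 + ?p 0 (S 0) \<le> makespan {..<2} ?p S \<tau>"
    "\<tau> 1 + ?p 1 (S 1) \<le> makespan {..<2} ?p S \<tau>"
    using completion_time_le_makespan[of "{..<2}" 0 \<tau> ?p S]
      completion_time_le_makespan[of "{..<2}" 1 \<tau> ?p S] by simp_all
  have sub: "S 0 \<subseteq> M" "S 1 \<subseteq> M" and nonneg: "0 \<le> \<tau> 0" "0 \<le> \<tau> 1"
    using feas by (auto simp: feasible_schedule_def)
  have ge1: "1 \<le> ?p j (S j)" for j
    using hidden_time_ge_1[of k \<H> "S j"] by linarith
  show ?thesis
  proof (cases "S 0 \<inter> S 1 = {}")
    case True
    have "card (S 0) + card (S 1) = card (S 0 \<union> S 1)"
      using True sub M(2) by (simp add: card_Un_disjoint finite_subset)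
    also have "\<dots> \<le> 2 * k"
      using sub M by (metis Un_least card_mono)
    \<comment> \<open>The split is asymmetric because only \<open>S 0\<close> is known to lie
      outside \<open>\<H>\<close>; size exactly \<open>k\<close> must therefore be charged to job
      0.\<close>
    finally consider "card (S 0) \<le> k" | "card (S 1) < k"
      by linarith
    then show ?thesis
    proof cases
      case 1
      then have "2 \<le> ?p 0 (S 0)"
        using S0 hidden_time_ge_2[of "S 0" k \<H>] by simp
      then show ?thesis
        using compl nonneg by linarith
    next
      case 2
      then have "2 \<le> ?p 1 (S 1)"
        by (simp add: hidden_time_def)
      then show ?thesis
        using compl nonneg by linarith
    qed
  next
    case False
    then obtain i where i: "i \<in> S 0" "i \<in> S 1" "i \<in> M"
      using sub by auto
    have disj: "{\<tau> 0 ..< \<tau> 0 + ?p 0 (S 0)} \<inter> {\<tau> 1 ..< \<tau> 1 + ?p 1 (S 1)} = {}"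
      using feas i unfolding feasible_schedule_def
      by (metis lessThan_iff one_less_numeral_iff pos2 semiring_norm(76) zero_neq_one)
    \<comment> \<open>The later start time would lie in both intervals unless one job has ended by
      the time the other starts.\<close>
    have "max (\<tau> 0) (\<tau> 1) \<notin> {\<tau> 0 ..< \<tau> 0 + ?p 0 (S 0)} \<inter> {\<tau> 1 ..< \<tau> 1 + ?p 1 (S 1)}"
      using disj by blast
    then have "\<tau> 0 + ?p 0 (S 0) \<le> \<tau> 1 \<or> \<tau> 1 + ?p 1 (S 1) \<le> \<tau> 0"
      using ge1[of 0] ge1[of 1] by (auto simp: max_def split: if_splits)
    then show ?thesis
      using compl nonneg ge1[of 0] ge1[of 1] by linarith
  qed
qed


section \<open>Instance sizes\<close>

text \<open>A linear bound suffices, since the values encoded are at most \<open>2 * k + 1\<close>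
  on \<open>2 * k\<close> machines.\<close>

lemma length_binary_le: "length (binary v) \<le> Suc v"
proof (induction v rule: less_induct)
  case (less v)
  show ?case
  proof (cases "v < 2")
    case False
    then have "length (binary (v div 2)) \<le> Suc (v div 2)"
      by (intro less.IH) simp
    then show ?thesis
      using False by (subst binary.simps) simp
  qed (simp add: binary.simps)
qed

lemma length_rat_word_of_nat_le: "length (rat_word (rat_of_nat v)) \<le> v + 3"
  using length_binary_le[of v] by (simp add: rat_word_def binary.simps[of "Suc 0"])

lemma instance_size_le:
  assumes "\<And>j S. j < n \<Longrightarrow> S \<subseteq> {..<m} \<Longrightarrow> length (rat_word (f j S)) \<le> b"
  shows "instance_size n m f \<le> n + m + b"
proof -
  let ?L = "insert 0 {length (rat_word (f j S)) | j S. j < n \<and> S \<subseteq> {..<m}}"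
  have sub: "?L \<subseteq> {..b}"
    using assms by auto
  then have "finite ?L"
    by (rule finite_subset) simp
  then have "Max ?L \<le> b"
    using sub by (subst Max_le_iff) auto
  then show ?thesis
    by (simp add: instance_size_def)
qed


section \<open>Runs of oracle machines\<close>

lemma funpow_step_Halt: "(step A ans ^^ t) (Halt, ts) = (Halt, ts)"
  by (induction t) simp_all

lemma funpow_step_halted_mono:
  assumes "(step A ans ^^ t) cfg = (Halt, ts)" "t \<le> t'"
  shows "(step A ans ^^ t') cfg = (Halt, ts)"
proof -
  have "(step A ans ^^ t') cfg = (step A ans ^^ (t' - t)) ((step A ans ^^ t) cfg)"
    using assms(2) by (metis comp_apply funpow_add le_add_diff_inverse2)
  then show ?thesis
    by (simp add: assms(1) funpow_step_Halt)
qed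

lemma step_cong:
  "ans (tape_word (snd cfg ! 1)) = ans' (tape_word (snd cfg ! 1)) \<Longrightarrow>
     step A ans cfg = step A ans' cfg"
  by (cases "(A, ans, cfg)" rule: step.cases) auto

text \<open>Agreement is demanded only on the tape words of the run with \<open>ans'\<close>, so one
  reference run determines all the queries that matter.\<close>

lemma funpow_step_cong:
  assumes "\<And>i. i < t \<Longrightarrow>
      ans (tape_word (snd ((step A ans' ^^ i) cfg) ! 1)) =
      ans' (tape_word (snd ((step A ans' ^^ i) cfg) ! 1))"
  shows "(step A ans ^^ t) cfg = (step A ans' ^^ t) cfg"
  using assms
proof (induction t)
  case (Suc t)
  then have "(step A ans ^^ t) cfg = (step A ans' ^^ t) cfg"
    by simp
  then show ?case
    using Suc.prems[of t] by (auto intro: step_cong)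
qed simp

text \<open>The only set at which \<open>value_answer\<close> can evaluate \<open>f\<close> on the
  word \<open>w\<close>; malformed words also get one, so no case distinction arises.\<close>

definition queried_set :: "nat \<Rightarrow> symbol list \<Rightarrow> nat set" where
  "queried_set m w =
     {i. i < m \<and> drop (Suc (length (takeWhile (\<lambda>s. s = Bit True) w))) w ! i = Bit True}"

lemma value_answer_cong:
  assumes "\<And>j. f j (queried_set m w) = f' j (queried_set m w)"
  shows "value_answer n m f w = value_answer n m f' w"
  using assms by (simp add: value_answer_def queried_set_def Let_def)

text \<open>The word starts with the \<open>m\<close> bits of \<open>S 0\<close>, so the set of job
  0 can be read off the output tape alone.\<close>

lemma schedule_word_first_set:
  assumes "0 < n" "S 0 \<subseteq> {..<m}"
  shows "{i. i < m \<and> schedule_word n m S \<tau> ! i = Bit True} = S 0"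
proof -
  have "[0..<n] = 0 # [1..<n]"
    using assms(1) by (simp add: upt_conv_Cons)
  then have "\<exists>rest. schedule_word n m S \<tau> = set_word m (S 0) @ rest"
    by (simp add: schedule_word_def)
  then show ?thesis
    using assms(2) by (auto simp: set_word_def nth_append)
qed


section \<open>Hiding a set from a short run\<close>

text \<open>Counting: \<open>B\<close> and the complements of its members together exclude at most
  \<open>2 * card B\<close> candidates.\<close>

lemma exists_avoiding_subset:
  fixes M :: "'m set"
  assumes M: "card M = 2 * k" "finite M" and B: "finite B" and less: "2 * card B < (2 * k) choose k"
  obtains H where "H \<subseteq> M" "card H = k" "H \<notin> B" "M - H \<notin> B"
proof -
  let ?B = "B \<union> (\<lambda>S. M - S) ` B"
  have "card ?B \<le> card B + card B"
    by (meson B card_Un_le card_image_le add_left_mono order_trans)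
  also have "\<dots> < card {H. H \<subseteq> M \<and> card H = k}"
    using less M n_subsets[of M k] by simp
  finally have "\<not> {H. H \<subseteq> M \<and> card H = k} \<subseteq> ?B"
    using B by (meson card_mono finite_UnI finite_imageI leD)
  then obtain H where H: "H \<subseteq> M" "card H = k" "H \<notin> ?B"
    by blast
  moreover have "M - H \<notin> B"
    using H by (metis UnI2 double_diff image_eqI subset_refl)
  ultimately show thesis
    using that by blast
qed

text \<open>The base \<open>4 * k + 6\<close> bounds the instance size
  \<open>2 + 2 * k + (2 * k + 4)\<close>. The added 1 is for the set that is output, the factor 2
  for complements.\<close>

lemma polynomial_less_central_binomial:
  "\<exists>k>0. 2 * (c * (4 * k + 6) ^ d + c + 1) < (2 * k) choose k"
proof -
  have "eventually (\<lambda>k::nat. 2 * (real c * (4 * real k + 6) ^ d + real c + 1) < 4 ^ k / (2 * real k)) at_top"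
    by real_asymp
  then obtain k :: nat where k: "0 < k"
    "2 * (real c * (4 * real k + 6) ^ d + real c + 1) < 4 ^ k / (2 * real k)"
    using eventually_gt_at_top[of 0]
    by (metis (mono_tags, lifting) eventually_at_top_linorder nle_le not_less_eq_eq less_eq_Suc_le)
  then have "real (2 * (c * (4 * k + 6) ^ d + c + 1)) < real ((2 * k) choose k)"
    using central_binomial_lower_bound[OF k(1)] by simp
  then show ?thesis
    using k(1) of_nat_less_iff by blast
qed

theorem theorem6p1:
  fixes \<epsilon> :: real
  assumes "\<epsilon> > 0"
    and "complexity_P \<noteq> complexity_NP"
  shows "\<not> (\<exists>A. poly_time_approx_algorithm (\<lambda>n. real n powr (1 - \<epsilon>)) A)"
proof
  assume "\<exists>A. poly_time_approx_algorithm (\<lambda>n. real n powr (1 - \<epsilon>)) A"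
  then obtain A c d where approx: "\<And>n m (f :: nat \<Rightarrow> nat set \<Rightarrow> rat).
      scheduling_instance {..<n} {..<m} (\<lambda>j S. real_of_rat (f j S)) \<Longrightarrow>
      \<exists>S \<tau>. outputs_within A (value_answer n m f) (input_word n m)
          (c * instance_size n m f ^ d + c) (schedule_word n m S \<tau>) \<and>
        feasible_schedule {..<n} {..<m} (\<lambda>j S. real_of_rat (f j S)) S (\<lambda>j. real_of_rat (\<tau> j)) \<and>
        makespan {..<n} (\<lambda>j S. real_of_rat (f j S)) S (\<lambda>j. real_of_rat (\<tau> j)) \<le>
          real n powr (1 - \<epsilon>) * optimal_makespan {..<n} {..<m} (\<lambda>j S. real_of_rat (f j S))"
    by (auto simp: poly_time_approx_algorithm_def Let_def)
  obtain k where k: "0 < k" and many: "2 * (c * (4 * k + 6) ^ d + c + 1) < (2 * k) choose k"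
    using polynomial_less_central_binomial by blast
  define m T where "m = 2 * k" and "T = c * (4 * k + 6) ^ d + c"
  define f :: "nat set set \<Rightarrow> nat \<Rightarrow> nat set \<Rightarrow> rat"
    where "f = (\<lambda>\<H> _ S. of_nat (hidden_time k \<H> S))"
  \<comment> \<open>The reference run is on the instance with nothing hidden. Hence
    \<open>B\<close>, the queried sets and the set read from the output, is fixed before
    \<open>H\<close> is chosen.\<close>
  define run where "run = (\<lambda>i. (step A (value_answer 2 m (f {})) ^^ i) (initial A (input_word 2 m)))"
  define S0 where "S0 = {i. i < m \<and> tape_word (snd (run T) ! 0) ! i = Bit True}"
  define B where "B = insert S0 ((\<lambda>i. queried_set m (tape_word (snd (run i) ! 1))) ` {..<T})"
  have "card B \<le> T + 1"
    unfolding B_def by (rule order_trans[OF card_insert_le_m1]) 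
       (use card_image_le[of "{..<T}"] in auto)
  then have "2 * card B < (2 * k) choose k"
    using many by (simp add: T_def)
  then obtain H where H: "H \<subseteq> {..<m}" "card H = k" "H \<notin> B" "{..<m} - H \<notin> B"
    by (rule exists_avoiding_subset[of "{..<m}" k B, rotated 3]) (auto simp: m_def B_def)
  define \<H> where "\<H> = {H, {..<m} - H}"
  have real_f: "(\<lambda>j S. real_of_rat (f \<H> j S)) = (\<lambda>_ S. real (hidden_time k \<H> S))"
    by (simp add: f_def)
  obtain S \<tau> where out: "outputs_within A (value_answer 2 m (f \<H>)) (input_word 2 m)
        (c * instance_size 2 m (f \<H>) ^ d + c) (schedule_word 2 m S \<tau>)"
    and feas: "feasible_schedule {..<2} {..<m} (\<lambda>_ S. real (hidden_time k \<H> S)) S (\<lambda>j. real_of_rat (\<tau> j))"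
    and guarantee: "makespan {..<2} (\<lambda>_ S. real (hidden_time k \<H> S)) S (\<lambda>j. real_of_rat (\<tau> j)) \<le>
        2 powr (1 - \<epsilon>) * optimal_makespan {..<2::nat} {..<m} (\<lambda>_ S. real (hidden_time k \<H> S))"
    using approx[of 2 m "f \<H>"] unfolding real_f
    by (auto simp: scheduling_instance_hidden_time)

  have "length (rat_word (f \<H> j R)) \<le> 2 * k + 4" for j R
    using length_rat_word_of_nat_le[of "hidden_time k \<H> R"] hidden_time_le[OF k, of \<H> R]
    by (simp add: f_def)
  then have "instance_size 2 m (f \<H>) \<le> 2 + m + (2 * k + 4)"
    by (intro instance_size_le)
  then have time: "c * instance_size 2 m (f \<H>) ^ d + c \<le> T"
    by (simp add: T_def m_def power_mono)
  \<comment> \<open>Hiding \<open>H\<close> changes values only at \<open>H\<close> and its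
    complement, both outside \<open>B\<close>, so the machine cannot tell the instances apart within
    \<open>T\<close> steps.\<close>
  have "f \<H> j R = f {} j R" if "R \<in> B" for j R
    using that H(3,4) by (auto simp: f_def hidden_time_def \<H>_def)
  then have same_run: "(step A (value_answer 2 m (f \<H>)) ^^ T) (initial A (input_word 2 m)) = run T"
    unfolding run_def
    by (intro funpow_step_cong value_answer_cong) (auto simp: B_def run_def)
  obtain ts where "(step A (value_answer 2 m (f \<H>)) ^^ T) (initial A (input_word 2 m)) = (Halt, ts)"
      and "tape_word (ts ! 0) = schedule_word 2 m S \<tau>"
    using out funpow_step_halted_mono[OF _ time] unfolding outputs_within_def by blast
  then have "tape_word (snd (run T) ! 0) = schedule_word 2 m S \<tau>"
    unfolding same_run by simp
  moreover have "S 0 \<subseteq> {..<m}"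
    using feas by (simp add: feasible_schedule_def)
  ultimately have "S 0 = S0"
    using schedule_word_first_set[of 2 S m \<tau>] by (simp add: S0_def)
  then have "S 0 \<notin> \<H>"
    using H(3,4) by (auto simp: \<H>_def B_def)
  then have "2 \<le> makespan {..<2} (\<lambda>_ S. real (hidden_time k \<H> S)) S (\<lambda>j. real_of_rat (\<tau> j))"
    using feas by (intro makespan_hidden_time_ge) (auto simp: m_def)
  also note guarantee
  also have "2 powr (1 - \<epsilon>) * optimal_makespan {..<2::nat} {..<m} (\<lambda>_ S. real (hidden_time k \<H> S))
      \<le> 2 powr (1 - \<epsilon>) * 1"
    unfolding \<H>_def using H(1,2)
    by (intro mult_left_mono optimal_makespan_hidden_time_le) (auto simp: m_def)
  also have "\<dots> < 2 powr 1"
    using assms(1) by (simp only: mult_1_right powr_less_cancel_iff)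
  finally show False
    by simp
qed

end
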